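(* Let $t_1,\dots,t_N\in[a,b]$ be time moments, let $n+1\ll N$, and let ${\bf B}_0$ be the $N\times(n+1)$ matrix whose $(i,j)$ entry is $g_j(t_i)$, where the basis functions are monomials $g_j(t)=t^{m_j}$, $j=1,\dots,n+1$ (some monomials may be missing, i.e. the exponents need not be consecutive). Then the matrix ${\bf B}_0^T{\bf B}_0$ is non-singular if and only if the corresponding Schur function $s_\lambda(t_1,\dots,t_{n+1})$ is non-zero.
   Context: The matrix ${\bf B}_0^T{\bf B}_0$ is the $(n+1)\times(n+1)$ system matrix of the normal equations for discrete least squares approximation at $t_1,\dots,t_N$ by linear combinations of the basis functions $g_1,\dots,g_{n+1}$. Write the exponents as $m_j=\lambda_j+(n+1)-j$ for $j=1,\dots,n+1$, and put $\lambda=(\lambda_1,\dots,\lambda_{n+1})$. The corresponding Schur function is defined by $$s_\lambda(t_1,\dots,t_{n+1})=\frac{\det(G)}{\det(V)},$$ where $G$ is the generalised Vandermonde matrix whose $(j,k)$ entry is $t_k^{m_j}$, $j,k=1,\dots,n+1$, and $V$ is the Vandermonde matrix, which is the case $\lambda_1=\dots=\lambda_{n+1}=0$ of $G$, so that its $(j,k)$ entry is $t_k^{\,n+1-j}$.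
   Formalization: "s_λ(t_1,…,t_{n+1}) is non-zero" is read as: non-zero at some n+1 pairwise distinct moments chosen from t_1,…,t_N; for the first n+1 moments the claim is false (n=0, m_1=1, t_1=0, t_2=1). "n+1≪N" is taken as n+1<N. *)

theory Defs
  imports "Jordan_Normal_Form.Determinant" "HOL.Real"
begin

(* Families (time moments, basis functions, exponents, parts) are functions on nat whose
   indices start at 1; the matrices of Jordan_Normal_Form are indexed from 0.
   This is the reason for every Suc below. *)

definition design_mat :: "nat \<Rightarrow> nat \<Rightarrow> (nat \<Rightarrow> real \<Rightarrow> real) \<Rightarrow> (nat \<Rightarrow> real) \<Rightarrow> real mat" where
  "design_mat N p g t = mat N p (\<lambda>(i, j). g (Suc j) (t (Suc i)))"

definition gen_vandermonde :: "nat \<Rightarrow> (nat \<Rightarrow> nat) \<Rightarrow> (nat \<Rightarrow> real) \<Rightarrow> real mat" where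
  "gen_vandermonde p m x = mat p p (\<lambda>(j, k). x (Suc k) ^ m (Suc j))"

definition schur_exponent :: "nat \<Rightarrow> (nat \<Rightarrow> nat) \<Rightarrow> nat \<Rightarrow> nat" where
  "schur_exponent p lam j = lam j + (p - j)"

definition vandermonde :: "nat \<Rightarrow> (nat \<Rightarrow> real) \<Rightarrow> real mat" where
  "vandermonde p x = gen_vandermonde p (schur_exponent p (\<lambda>_. 0)) x"

(* The value of the Schur function at (x 1, ..., x p), as a quotient of determinants.
   It is meaningful only if x 1, ..., x p are pairwise distinct; otherwise both
   determinants vanish and HOL's convention 0 / 0 = 0 applies. *)
definition schur :: "nat \<Rightarrow> (nat \<Rightarrow> nat) \<Rightarrow> (nat \<Rightarrow> real) \<Rightarrow> real" where
  "schur p lam x =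
     det (gen_vandermonde p (schur_exponent p lam) x) / det (vandermonde p x)"

(* sel picks the indices sel 1 < ... < sel p out of {1..N} in such a way that the chosen
   time moments are pairwise distinct, so that the quotient defining schur makes sense. *)
definition admissible_selection :: "nat \<Rightarrow> nat \<Rightarrow> (nat \<Rightarrow> real) \<Rightarrow> (nat \<Rightarrow> nat) \<Rightarrow> bool" where
  "admissible_selection N p t sel \<longleftrightarrow>
     strict_mono_on {1..p} sel \<and> sel ` {1..p} \<subseteq> {1..N} \<and> inj_on (t \<circ> sel) {1..p}"

end

theory Submission
  imports Defs "Jordan_Normal_Form.Matrix_Kernel"
begin

text \<open>
  Write \<open>B\<close> for the design matrix and \<open>p = n + 1\<close> for the number of its columns. Over the reals
  \<open>v \<bullet> (B\<^sup>T * B) v = \<bar>B v\<bar>\<^sup>2\<close>, so the normal equations are non-singular if and only if \<open>B\<close> has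
  trivial kernel (\<open>mat_kernel_gram\<close>). The rest of the argument compares \<open>B\<close> with its
  \<open>p \<times> p\<close> blocks of rows, because the transpose of such a block, taken at the rows
  \<open>sel 1, \<dots>, sel p\<close>, is exactly the generalised Vandermonde matrix at the moments
  \<open>t (sel 1), \<dots>, t (sel p)\<close>, the numerator of the Schur function.

  If some Schur value is non-zero, so is its numerator; the corresponding block is then
  non-singular, and a vector killed by \<open>B\<close> is killed by the block, hence zero. Conversely, if \<open>B\<close>
  has trivial kernel, then some \<open>p\<close> of its rows form a non-singular block. This is the fact that
  row rank and column rank agree, proved in \<open>exists_nonsingular_row_selection\<close> in the form that
  is needed here. The moments of this block are automatically distinct, since a repeated moment
  would give two equal columns in the generalised Vandermonde matrix. At distinct moments the
  denominator of the Schur function does not vanish (\<open>det_vandermonde_nonzero\<close>), so the Schur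
  value is non-zero.
\<close>

section \<open>Kernels and determinants\<close>

text \<open>
  A homogeneous system with fewer equations than unknowns has a non-trivial solution: padding the
  matrix with zero rows makes it square, and a zero row forces the determinant to vanish.
\<close>
lemma exists_kernel_vec_of_wide_mat:
  fixes A :: "'a :: field mat"
  assumes A: "A \<in> carrier_mat r c" and "r < c"
  shows "\<exists>v \<in> mat_kernel A. v \<noteq> 0\<^sub>v c"
proof -
  define P where "P = mat c c (\<lambda>(i, j). if i < r then A $$ (i, j) else 0)"
  have P: "P \<in> carrier_mat c c"
    by (simp add: P_def)
  \<comment> \<open>Row \<open>r\<close> of \<open>P\<close> is the first of the padding rows.\<close>
  have "P\<^sup>T *\<^sub>v unit_vec c r = 0\<^sub>v c"
    using \<open>r < c\<close> by (intro eq_vecI) (auto simp: P_def)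
  moreover have "unit_vec c r \<noteq> (0\<^sub>v c :: 'a vec)"
    using \<open>r < c\<close> by simp
  ultimately have "det P\<^sup>T = 0"
    using det_0_iff_vec_prod_zero_field[OF transpose_carrier_mat[THEN iffD2, OF P]] unit_vec_carrier[of c r]
    by blast
  then have "det P = 0"
    using det_transpose[OF P] by simp
  then obtain v where v: "v \<in> carrier_vec c" "v \<noteq> 0\<^sub>v c" "P *\<^sub>v v = 0\<^sub>v c"
    using det_0_iff_vec_prod_zero_field[OF P] by blast
  have "A *\<^sub>v v = 0\<^sub>v r"
  proof (rule eq_vecI)
    fix i assume "i < dim_vec (0\<^sub>v r)"
    then have i: "i < r" by simp
    then have "row A i = row P i"
      using A \<open>r < c\<close> by (intro eq_vecI) (auto simp: P_def)
    moreover have "(P *\<^sub>v v) $ i = 0"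
      using v i \<open>r < c\<close> by simp
    ultimately show "(A *\<^sub>v v) $ i = 0\<^sub>v r $ i"
      using A P i \<open>r < c\<close> by simp
  qed (use A in simp)
  then show ?thesis
    using v mat_kernelI[OF A] by blast
qed

lemma det_nonzero_iff_trivial_kernel:
  fixes A :: "'a :: field mat"
  assumes A: "A \<in> carrier_mat n n"
  shows "det A \<noteq> 0 \<longleftrightarrow> mat_kernel A \<subseteq> {0\<^sub>v n}"
  using det_0_iff_vec_prod_zero_field[OF A] by (auto simp: mat_kernel[OF A])

lemma invertible_mat_iff_det_nonzero:
  fixes A :: "'a :: field mat"
  assumes A: "A \<in> carrier_mat n n"
  shows "invertible_mat A \<longleftrightarrow> det A \<noteq> 0"
proof
  assume "invertible_mat A"
  then obtain B where AB: "A * B = 1\<^sub>m n" and BA: "B * A = 1\<^sub>m (dim_row B)"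
    using A by (auto simp: invertible_mat_def inverts_mat_def)
  have "dim_col B = n" "dim_row B = n"
    using arg_cong[OF AB, of dim_col] arg_cong[OF BA, of dim_col] A by auto
  then have "det A * det B = 1"
    using det_mult[OF A, of B] AB by auto
  then show "det A \<noteq> 0" by auto
next
  assume "det A \<noteq> 0"
  from det_non_zero_imp_unit[OF A this, of "()"]
  obtain B where "B \<in> carrier_mat n n" "B * A = 1\<^sub>m n" "A * B = 1\<^sub>m n"
    by (auto simp: Units_def ring_mat_def)
  then show "invertible_mat A"
    using A by (auto simp: invertible_mat_def inverts_mat_def)
qed

text \<open>
  The real field matters: a sum of squares vanishes only if each square does, so
  \<open>B\<^sup>T (B v) = 0\<close> already gives \<open>B v = 0\<close>.
\<close>
lemma mat_kernel_gram:
  fixes B :: "real mat"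
  assumes B: "B \<in> carrier_mat N p"
  shows "mat_kernel (B\<^sup>T * B) = mat_kernel B"
proof -
  have BB: "B\<^sup>T * B \<in> carrier_mat p p"
    using B by simp
  have "B *\<^sub>v v = 0\<^sub>v N" if v: "v \<in> carrier_vec p" and 0: "(B\<^sup>T * B) *\<^sub>v v = 0\<^sub>v p" for v
  proof -
    have Bv: "B *\<^sub>v v \<in> carrier_vec N"
      using B v by auto
    have "(B *\<^sub>v v) \<bullet> (B *\<^sub>v v) = (B\<^sup>T *\<^sub>v (B *\<^sub>v v)) \<bullet> v"
      using transpose_vec_mult_scalar[OF B v Bv] by simp
    also have "B\<^sup>T *\<^sub>v (B *\<^sub>v v) = 0\<^sub>v p"
      using 0 assoc_mult_mat_vec[of "B\<^sup>T" p N B p v] B v by simp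
    finally have "(B *\<^sub>v v) \<bullet> (B *\<^sub>v v) = 0"
      using v by simp
    moreover have "conjugate (B *\<^sub>v v) = B *\<^sub>v v"
      by (intro eq_vecI) (auto simp: conjugate_real_def)
    ultimately show ?thesis
      using conjugate_square_eq_0_vec[OF Bv] by simp
  qed
  moreover have "(B\<^sup>T * B) *\<^sub>v v = 0\<^sub>v p" if "v \<in> carrier_vec p" "B *\<^sub>v v = 0\<^sub>v N" for v
    using that B assoc_mult_mat_vec[of "B\<^sup>T" p N B p v] by auto
  ultimately show ?thesis
    unfolding mat_kernel[OF B] mat_kernel[OF BB] by blast
qed

section \<open>Selecting a square block of rows\<close>

text \<open>
  Call a set of rows separating if only the zero vector is orthogonal to all of them. All rows
  together are separating; let \<open>J\<close> be a separating set with the least number \<open>q\<close> of elements.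
  Fewer than \<open>p\<close> vectors cannot be separating, so \<open>p \<le> q\<close>. By minimality, dropping any row of
  \<open>J\<close> admits a non-zero vector orthogonal to the remaining rows, and this vector is not
  orthogonal to the dropped row. These \<open>q\<close> vectors are biorthogonal to the rows in \<open>J\<close> up to
  non-zero factors, hence linearly independent in dimension \<open>p\<close>, so \<open>q \<le> p\<close>. The rows in \<open>J\<close>
  therefore form a square matrix with trivial kernel.
\<close>
lemma exists_nonsingular_row_selection:
  fixes A :: "'a :: field mat"
  assumes A: "A \<in> carrier_mat N p" and ker: "mat_kernel A \<subseteq> {0\<^sub>v p}"
  shows "\<exists>h. strict_mono_on {..<p} h \<and> h ` {..<p} \<subseteq> {..<N}
           \<and> det (mat p p (\<lambda>(i, j). A $$ (h i, j))) \<noteq> 0"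
proof -
  define separates where "separates J \<longleftrightarrow> J \<subseteq> {..<N} \<and>
    (\<forall>v \<in> carrier_vec p. (\<forall>i \<in> J. row A i \<bullet> v = 0) \<longrightarrow> v = 0\<^sub>v p)" for J
  have "v = 0\<^sub>v p" if "v \<in> carrier_vec p" "\<forall>i \<in> {..<N}. row A i \<bullet> v = 0" for v
  proof -
    have "A *\<^sub>v v = 0\<^sub>v N"
      using that A by (intro eq_vecI) auto
    then show ?thesis
      using ker that(1) mat_kernelI[OF A] by auto
  qed
  then have "separates {..<N}"
    by (simp add: separates_def)
  then obtain J where J: "separates J" and least: "\<And>J'. separates J' \<Longrightarrow> card J \<le> card J'"
    using ex_has_least_nat[of separates _ card] by blast
  have JN: "J \<subseteq> {..<N}"
    using J by (simp add: separates_def)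
  then have "finite J"
    by (rule finite_subset) simp
  define q where "q = card J"
  obtain h where h: "bij_betw h {..<q} J" "strict_mono_on {..<q} h"
    using ex_bij_betw_strict_mono_card[OF \<open>finite J\<close>] q_def by blast
  have hJ: "h ` {..<q} = J" and inj: "inj_on h {..<q}"
    using h(1) by (auto simp: bij_betw_def)
  have hN: "h i < N" if "i < q" for i
    using hJ JN that by auto
  define R where "R = mat q p (\<lambda>(i, j). A $$ (h i, j))"
  have R: "R \<in> carrier_mat q p"
    by (simp add: R_def)
  have row_R: "row R i = row A (h i)" if "i < q" for i
    using that A hN[OF that] by (intro eq_vecI) (auto simp: R_def)
  have ker_R: "mat_kernel R \<subseteq> {0\<^sub>v p}"
  proof
    fix v assume "v \<in> mat_kernel R"
    then have v: "v \<in> carrier_vec p" "R *\<^sub>v v = 0\<^sub>v q"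
      using mat_kernelD[OF R] by auto
    have "row A (h i) \<bullet> v = 0" if "i < q" for i
      using arg_cong[OF v(2), of "\<lambda>u. u $ i"] that R row_R by simp
    then have "\<forall>i \<in> J. row A i \<bullet> v = 0"
      using hJ by auto
    then show "v \<in> {0\<^sub>v p}"
      using J v(1) by (simp add: separates_def)
  qed
  have "p \<le> q"
    using exists_kernel_vec_of_wide_mat[OF R] ker_R by (meson not_le singletonD subsetD)
  \<comment> \<open>Minimality of \<open>J\<close> yields the family that is biorthogonal up to scaling.\<close>
  have "\<exists>w \<in> carrier_vec p. row A (h i) \<bullet> w \<noteq> 0 \<and> (\<forall>k<q. k \<noteq> i \<longrightarrow> row A (h k) \<bullet> w = 0)"
    if i: "i < q" for i
  proof -
    have hi: "h i \<in> J"
      using hJ i by auto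
    then have "card (J - {h i}) < card J"
      using \<open>finite J\<close> by (meson card_Diff1_less)
    then have "\<not> separates (J - {h i})"
      using least by (meson not_le)
    then obtain w where w: "w \<in> carrier_vec p" "w \<noteq> 0\<^sub>v p"
        "\<forall>k \<in> J - {h i}. row A k \<bullet> w = 0"
      using JN by (auto simp: separates_def)
    have "row A (h i) \<bullet> w \<noteq> 0"
      using w J by (force simp: separates_def)
    moreover have "row A (h k) \<bullet> w = 0" if "k < q" "k \<noteq> i" for k
      using w(3) that i hJ inj by (auto simp: inj_on_def)
    ultimately show ?thesis
      using w(1) by blast
  qed
  then obtain w where w: "\<And>i. i < q \<Longrightarrow> w i \<in> carrier_vec p"
    "\<And>i. i < q \<Longrightarrow> row A (h i) \<bullet> w i \<noteq> 0"
    "\<And>i k. i < q \<Longrightarrow> k < q \<Longrightarrow> k \<noteq> i \<Longrightarrow> row A (h k) \<bullet> w i = 0"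
    by metis
  define W where "W = mat p q (\<lambda>(j, i). w i $ j)"
  have W: "W \<in> carrier_mat p q"
    by (simp add: W_def)
  have col_W: "col W i = w i" if "i < q" for i
    using w(1)[OF that] that by (intro eq_vecI) (auto simp: W_def)
  \<comment> \<open>\<open>R * W\<close> is diagonal with non-zero diagonal, so \<open>W c = 0\<close> forces \<open>c = 0\<close>.\<close>
  have "mat_kernel W \<subseteq> {0\<^sub>v q}"
  proof
    fix c assume "c \<in> mat_kernel W"
    then have c: "c \<in> carrier_vec q" "W *\<^sub>v c = 0\<^sub>v p"
      using mat_kernelD[OF W] by auto
    have RWc: "(R * W) *\<^sub>v c = 0\<^sub>v q"
      using assoc_mult_mat_vec[OF R W c(1)] c(2) R by auto
    have "c $ i = 0" if i: "i < q" for i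
    proof -
      have "0 = ((R * W) *\<^sub>v c) $ i"
        using RWc i by simp
      also have "\<dots> = (\<Sum>k<q. (row A (h i) \<bullet> w k) * c $ k)"
        using i R W c(1) by (simp add: scalar_prod_def[of _ c] row_R col_W lessThan_atLeast0
            del: assoc_mult_mat_vec)
      also have "\<dots> = (\<Sum>k<q. if k = i then (row A (h i) \<bullet> w i) * c $ i else 0)"
        using i w(3) by (intro sum.cong) auto
      also have "\<dots> = (row A (h i) \<bullet> w i) * c $ i"
        using i by simp
      finally show ?thesis
        using w(2)[OF i] by simp
    qed
    then show "c \<in> {0\<^sub>v q}"
      using c(1) by (auto intro!: eq_vecI)
  qed
  then have "q \<le> p"
    using exists_kernel_vec_of_wide_mat[OF W] by (meson not_le singletonD subsetD)
  with \<open>p \<le> q\<close> have "q = p" by simp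
  have "det R \<noteq> 0"
    using det_nonzero_iff_trivial_kernel[of R p] R ker_R \<open>q = p\<close> by simp
  then show ?thesis
    using h(2) hJ JN \<open>q = p\<close> R_def by blast
qed

section \<open>Vandermonde matrices and the Schur function\<close>

text \<open>
  A vector in the kernel of the transpose is the coefficient list of a polynomial of degree less
  than \<open>p\<close> that vanishes at the \<open>p\<close> distinct nodes; such a polynomial is zero.
\<close>
lemma det_vandermonde_nonzero:
  assumes inj: "inj_on x {1..p}"
  shows "det (vandermonde p x) \<noteq> 0"
proof -
  define V where "V = vandermonde p x"
  have V: "V \<in> carrier_mat p p"
    by (simp add: V_def vandermonde_def gen_vandermonde_def)
  have "mat_kernel V\<^sup>T \<subseteq> {0\<^sub>v p}"
  proof
    fix v assume "v \<in> mat_kernel V\<^sup>T"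
    then have v: "v \<in> carrier_vec p" "V\<^sup>T *\<^sub>v v = 0\<^sub>v p"
      using mat_kernelD[of "V\<^sup>T" p p] V by auto
    define f where "f = (\<Sum>j<p. monom (v $ j) (p - Suc j))"
    have coeff_f: "coeff f (p - Suc j) = v $ j" if "j < p" for j
    proof -
      have "coeff f (p - Suc j) = (\<Sum>i<p. if i = j then v $ j else 0)"
        unfolding f_def coeff_sum using that by (intro sum.cong) auto
      then show ?thesis
        using that by simp
    qed
    have "poly f (x i) = 0" if i: "i \<in> {1..p}" for i
    proof -
      obtain k where k: "i = Suc k" "k < p"
        using i that[of "i - 1"] by auto
      have "poly f (x i) = (V\<^sup>T *\<^sub>v v) $ k"
        using k V v(1)
        by (simp add: f_def poly_sum poly_monom scalar_prod_def V_def vandermonde_def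
            gen_vandermonde_def schur_exponent_def lessThan_atLeast0 mult.commute)
      then show ?thesis
        using v(2) k by simp
    qed
    then have roots: "x ` {1..p} \<subseteq> {y. poly f y = 0}" by auto
    have "f = 0"
    proof (rule ccontr)
      assume "f \<noteq> 0"
      then have "card (x ` {1..p}) \<le> degree f"
        using card_mono[OF poly_roots_finite roots] card_poly_roots_bound[of f] by simp
      then have "p \<le> degree f"
        using card_image[OF inj] by simp
      moreover have "degree f \<le> p - 1"
        unfolding f_def by (intro degree_sum_le) (auto intro: order.trans[OF degree_monom_le])
      \<comment> \<open>Truncated subtraction leaves the case \<open>p = 0\<close>, where \<open>f\<close> is an empty sum.\<close>
      ultimately have "p = 0" by simp
      then show False
        using \<open>f \<noteq> 0\<close> by (simp add: f_def)
    qed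
    then have "v $ j = 0" if "j < p" for j
      using coeff_f[OF that] by simp
    then show "v \<in> {0\<^sub>v p}"
      using v(1) by (auto intro!: eq_vecI)
  qed
  then have "det V\<^sup>T \<noteq> 0"
    using det_nonzero_iff_trivial_kernel[of "V\<^sup>T" p] V by simp
  then show ?thesis
    using det_transpose[OF V] V_def by simp
qed

lemma det_gen_vandermonde_nonzero_imp_inj:
  assumes "det (gen_vandermonde p m x) \<noteq> 0"
  shows "inj_on x {1..p}"
proof (rule inj_onI, rule ccontr)
  fix i k assume ik: "i \<in> {1..p}" "k \<in> {1..p}" "x i = x k" "i \<noteq> k"
  let ?G = "gen_vandermonde p m x"
  have "col ?G (i - 1) = col ?G (k - 1)"
    using ik by (intro eq_vecI) (auto simp: gen_vandermonde_def)
  moreover have "?G \<in> carrier_mat p p"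
    by (simp add: gen_vandermonde_def)
  moreover have "i - 1 \<noteq> k - 1" "i - 1 < p" "k - 1 < p"
    using ik by auto
  ultimately show False
    using assms det_identical_columns by blast
qed

text \<open>
  This identifies the numerator of the Schur function with a minor of the design matrix. The
  selection \<open>sel\<close> counts rows and nodes from 1, whereas \<open>h\<close> counts matrix rows from 0; the
  second hypothesis translates between the two.
\<close>
lemma gen_vandermonde_eq_transpose_row_selection:
  assumes "\<And>j. j \<in> {1..p} \<Longrightarrow> g j = (\<lambda>x. x ^ m j)"
    and "\<And>k. k \<in> {1..p} \<Longrightarrow> sel k = Suc (h (k - 1))" and "h ` {..<p} \<subseteq> {..<N}"
  shows "gen_vandermonde p m (t \<circ> sel) = (mat p p (\<lambda>(i, j). design_mat N p g t $$ (h i, j)))\<^sup>T"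
  using assms by (intro eq_matI) (auto simp: gen_vandermonde_def design_mat_def image_subset_iff)

theorem theorem4p1:
  fixes a b :: real and n N :: nat
    and t :: "nat \<Rightarrow> real" and g :: "nat \<Rightarrow> real \<Rightarrow> real"
    and m lam :: "nat \<Rightarrow> nat"
  assumes "\<And>i. i \<in> {1..N} \<Longrightarrow> t i \<in> {a..b}"
    and "n + 1 < N"
    and "\<And>j. j \<in> {1..n + 1} \<Longrightarrow> g j = (\<lambda>x. x ^ m j)"
    and "\<And>j. j \<in> {1..n + 1} \<Longrightarrow> m j = lam j + (n + 1 - j)"
    and "\<And>j k. 1 \<le> j \<Longrightarrow> j \<le> k \<Longrightarrow> k \<le> n + 1 \<Longrightarrow> lam k \<le> lam j"
  shows "invertible_mat (transpose_mat (design_mat N (n + 1) g t) * design_mat N (n + 1) g t) \<longleftrightarrow>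
    (\<exists>sel. admissible_selection N (n + 1) t sel \<and> schur (n + 1) lam (t \<circ> sel) \<noteq> 0)"
proof -
  define p where "p = n + 1"
  define B where "B = design_mat N p g t"
  define e where "e = schur_exponent p lam"
  have B: "B \<in> carrier_mat N p"
    by (simp add: B_def design_mat_def)
  have g: "g j = (\<lambda>x. x ^ e j)" if "j \<in> {1..p}" for j
    using assms(3,4) that by (simp add: p_def e_def schur_exponent_def)
  have gram: "invertible_mat (B\<^sup>T * B) \<longleftrightarrow> mat_kernel B \<subseteq> {0\<^sub>v p}"
    using B invertible_mat_iff_det_nonzero[of "B\<^sup>T * B" p]
      det_nonzero_iff_trivial_kernel[of "B\<^sup>T * B" p] mat_kernel_gram[OF B] by simp
  have "\<exists>sel. admissible_selection N p t sel \<and> schur p lam (t \<circ> sel) \<noteq> 0"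
    if ker: "mat_kernel B \<subseteq> {0\<^sub>v p}"
  proof -
    obtain h where h: "strict_mono_on {..<p} h" "h ` {..<p} \<subseteq> {..<N}"
        "det (mat p p (\<lambda>(i, j). B $$ (h i, j))) \<noteq> 0"
      using exists_nonsingular_row_selection[OF B ker] by blast
    define sel where "sel k = Suc (h (k - 1))" for k
    have "gen_vandermonde p e (t \<circ> sel) = (mat p p (\<lambda>(i, j). B $$ (h i, j)))\<^sup>T"
      unfolding B_def
      by (rule gen_vandermonde_eq_transpose_row_selection[OF g]) (use h(2) sel_def in auto)
    then have det: "det (gen_vandermonde p e (t \<circ> sel)) \<noteq> 0"
      using h(3) by (simp add: det_transpose[of _ p])
    \<comment> \<open>Nothing in the choice of rows made the moments distinct; the determinant does.\<close>
    then have inj: "inj_on (t \<circ> sel) {1..p}"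
      by (rule det_gen_vandermonde_nonzero_imp_inj)
    have "strict_mono_on {1..p} sel"
    proof (rule strict_mono_onI)
      fix r s assume "r \<in> {1..p}" "s \<in> {1..p}" "r < s"
      then show "sel r < sel s"
        using strict_mono_onD[OF h(1), of "r - 1" "s - 1"] by (simp add: sel_def)
    qed
    moreover have "sel ` {1..p} \<subseteq> {1..N}"
      using h(2) by (auto simp: sel_def image_subset_iff Suc_le_eq)
    moreover have "schur p lam (t \<circ> sel) \<noteq> 0"
      using det det_vandermonde_nonzero[OF inj] by (simp add: schur_def e_def)
    ultimately show ?thesis
      using inj by (auto simp: admissible_selection_def)
  qed
  moreover have "mat_kernel B \<subseteq> {0\<^sub>v p}"
    if sel: "admissible_selection N p t sel" and schur: "schur p lam (t \<circ> sel) \<noteq> 0" for sel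
  proof -
    define h where "h i = sel (Suc i) - 1" for i
    define R where "R = mat p p (\<lambda>(i, j). B $$ (h i, j))"
    have R: "R \<in> carrier_mat p p"
      by (simp add: R_def)
    have sel_N: "sel k \<in> {1..N}" if "k \<in> {1..p}" for k
      using sel that unfolding admissible_selection_def by blast
    have h_N: "h i < N" if "i < p" for i
      using sel_N[of "Suc i"] that by (auto simp: h_def)
    have "gen_vandermonde p e (t \<circ> sel) = R\<^sup>T"
      unfolding R_def B_def
    proof (rule gen_vandermonde_eq_transpose_row_selection[OF g])
      show "sel k = Suc (h (k - 1))" if "k \<in> {1..p}" for k
        using sel_N[OF that] that by (simp add: h_def)
    qed (use h_N in auto)
    moreover have "det (gen_vandermonde p e (t \<circ> sel)) \<noteq> 0"
      using schur by (auto simp: schur_def e_def)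
    ultimately have "mat_kernel R \<subseteq> {0\<^sub>v p}"
      using det_nonzero_iff_trivial_kernel[OF R] det_transpose[OF R] by simp
    moreover have "mat_kernel B \<subseteq> mat_kernel R"
    proof
      fix v assume "v \<in> mat_kernel B"
      then have v: "v \<in> carrier_vec p" "B *\<^sub>v v = 0\<^sub>v N"
        using mat_kernelD[OF B] by auto
      have "(R *\<^sub>v v) $ i = 0" if i: "i < p" for i
      proof -
        have "row R i = row B (h i)"
          using B h_N[OF i] i by (intro eq_vecI) (auto simp: R_def)
        then have "(R *\<^sub>v v) $ i = (B *\<^sub>v v) $ h i"
          using B R h_N[OF i] i by simp
        then show ?thesis
          using v(2) h_N[OF i] by simp
      qed
      then have "R *\<^sub>v v = 0\<^sub>v p"
        using R by (intro eq_vecI) auto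
      then show "v \<in> mat_kernel R"
        using mat_kernelI[OF R] v(1) by blast
    qed
    ultimately show ?thesis by blast
  qed
  ultimately show ?thesis
    using gram unfolding B_def p_def by blast
qed

end
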